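(* Let $\mathcal V$ be a multivector field on $X$, assume $X$ is invariant, and let $\varphi$ be an essential full solution in $X$. Then both limit sets $\alpha(\varphi)$ and $\omega(\varphi)$ are nonempty, strongly connected isolated invariant sets.
   Context: $X$ is a finite $T_0$ topological space. For $A\subset X$, $\operatorname{cl}A$ is its closure and $\operatorname{mo}A:=\operatorname{cl}A\setminus A$. $A$ is locally closed if it is the intersection of an open and a closed subset of $X$. $H$ denotes relative singular homology. A multivector is a nonempty locally closed subset of $X$; a multivector field $\mathcal V$ on $X$ is a partition of $X$ into multivectors. For $x\in X$, $[x]$ denotes the element of $\mathcal V$ containing $x$. A multivector $V$ is critical if $H(\operatorname{cl}V,\operatorname{mo}V)\neq0$, regular otherwise. $A\subset X$ is $\mathcal V$-compatible if for every $x\in X$ either $[x]\cap A=\emptyset$ or $[x]\subset A$. Put $\Pi_{\mathcal V}(x):=[x]\cup\operatorname{cl}\{x\}$ and $\Pi_{\mathcal V}(A):=\bigcup_{x\in A}\Pi_{\mathcal V}(x)$. A $\mathbb Z$-interval is $\mathbb Z\cap I$ for a real interval $I$. A solution in $A\subset X$ is a map $\varphi:D\to A$ on a $\mathbb Z$-interval $D$ with $\varphi(i+1)\in\Pi_{\mathcal V}(\varphi(i))$ whenever $i,i+1\in D$; it is full if $D=\mathbb Z$, and a path if $D$ is bounded, going from $\varphi(\min D)$ to $\varphi(\max D)$. A full solution $\varphi$ is essential if for every $t\in\mathbb Z$ with $[\varphi(t)]$ regular, the set $\{s\in\mathbb Z:\varphi(s)\notin[\varphi(t)]\}$ is unbounded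 below and unbounded above. $\operatorname{Inv}A$ is the set of $x\in A$ such that there is an essential full solution $\varphi$ with image in $A$ and $\varphi(0)=x$; $A$ is invariant if $\operatorname{Inv}A=A$. A closed set $N$ isolates an invariant set $S\subset N$ if (a) every path in $N$ with both endpoints in $S$ has image contained in $S$, and (b) $\Pi_{\mathcal V}(S)\subset N$. An invariant set is an isolated invariant set if some closed set isolates it. A nonempty set $A$ is strongly connected if for all $x,y\in A$ there is a path in $A$ from $x$ to $y$. For a full solution $\varphi$: $\operatorname{uim}^-\varphi:=\bigcap_{t\le0}\varphi((-\infty,t])$ and $\operatorname{uim}^+\varphi:=\bigcap_{t\ge0}\varphi([t,\infty))$. The $\mathcal V$-hull $\langle A\rangle_{\mathcal V}$ of $A\subset X$ is the intersection of all $\mathcal V$-compatible, locally closed subsets of $X$ containing $A$. The limit sets are $\alpha(\varphi):=\langle\operatorname{uim}^-\varphi\rangle_{\mathcal V}$ and $\omega(\varphi):=\langle\operatorname{uim}^+\varphi\rangle_{\mathcal V}$. *)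

theory Defs
  imports "HOL-Analysis.Analysis" "HOL-Homology.Homology" "HOL-Library.Disjoint_Sets"
begin

definition finite_T0 :: "'a topology \<Rightarrow> bool" where
  "finite_T0 X \<longleftrightarrow> finite (topspace X) \<and> t0_space X"

definition mo :: "'a topology \<Rightarrow> 'a set \<Rightarrow> 'a set" where
  "mo X A = X closure_of A - A"

definition locally_closed_in :: "'a topology \<Rightarrow> 'a set \<Rightarrow> bool" where
  "locally_closed_in X A \<longleftrightarrow> (\<exists>U C. openin X U \<and> closedin X C \<and> A = U \<inter> C)"

definition multivector :: "'a topology \<Rightarrow> 'a set \<Rightarrow> bool" where
  "multivector X A \<longleftrightarrow> A \<noteq> {} \<and> locally_closed_in X A"

definition multivector_field :: "'a topology \<Rightarrow> 'a set set \<Rightarrow> bool" where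
  "multivector_field X V \<longleftrightarrow> partition_on (topspace X) V \<and> (\<forall>A\<in>V. multivector X A)"

definition cell :: "'a set set \<Rightarrow> 'a \<Rightarrow> 'a set" where
  "cell V x = (THE A. A \<in> V \<and> x \<in> A)"

definition critical :: "'a topology \<Rightarrow> 'a set \<Rightarrow> bool" where
  "critical X A \<longleftrightarrow>
     (\<exists>p. \<not> trivial_group (relative_homology_group p (subtopology X (X closure_of A)) (mo X A)))"

definition regular :: "'a topology \<Rightarrow> 'a set \<Rightarrow> bool" where
  "regular X A \<longleftrightarrow> \<not> critical X A"

definition compatible :: "'a topology \<Rightarrow> 'a set set \<Rightarrow> 'a set \<Rightarrow> bool" where
  "compatible X V A \<longleftrightarrow> (\<forall>x\<in>topspace X. cell V x \<inter> A = {} \<or> cell V x \<subseteq> A)"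

definition PiV :: "'a topology \<Rightarrow> 'a set set \<Rightarrow> 'a \<Rightarrow> 'a set" where
  "PiV X V x = cell V x \<union> X closure_of {x}"

definition PiV_set :: "'a topology \<Rightarrow> 'a set set \<Rightarrow> 'a set \<Rightarrow> 'a set" where
  "PiV_set X V A = (\<Union>x\<in>A. PiV X V x)"

definition full_solution :: "'a topology \<Rightarrow> 'a set set \<Rightarrow> 'a set \<Rightarrow> (int \<Rightarrow> 'a) \<Rightarrow> bool" where
  "full_solution X V A \<phi> \<longleftrightarrow> (\<forall>i. \<phi> i \<in> A) \<and> (\<forall>i. \<phi> (i + 1) \<in> PiV X V (\<phi> i))"

definition path_in :: "'a topology \<Rightarrow> 'a set set \<Rightarrow> 'a set \<Rightarrow> (int \<Rightarrow> 'a) \<Rightarrow> int \<Rightarrow> int \<Rightarrow> bool" where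
  "path_in X V A \<phi> a b \<longleftrightarrow> a \<le> b \<and> (\<forall>i\<in>{a..b}. \<phi> i \<in> A)
       \<and> (\<forall>i\<in>{a..<b}. \<phi> (i + 1) \<in> PiV X V (\<phi> i))"

definition essential :: "'a topology \<Rightarrow> 'a set set \<Rightarrow> (int \<Rightarrow> 'a) \<Rightarrow> bool" where
  "essential X V \<phi> \<longleftrightarrow>
     (\<forall>t. regular X (cell V (\<phi> t)) \<longrightarrow>
        (\<forall>n. \<exists>s<n. \<phi> s \<notin> cell V (\<phi> t)) \<and> (\<forall>n. \<exists>s>n. \<phi> s \<notin> cell V (\<phi> t)))"

definition Inv :: "'a topology \<Rightarrow> 'a set set \<Rightarrow> 'a set \<Rightarrow> 'a set" where
  "Inv X V A = {x \<in> A. \<exists>\<phi>. full_solution X V A \<phi> \<and> essential X V \<phi> \<and> \<phi> 0 = x}"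

definition invariant :: "'a topology \<Rightarrow> 'a set set \<Rightarrow> 'a set \<Rightarrow> bool" where
  "invariant X V A \<longleftrightarrow> Inv X V A = A"

definition isolates :: "'a topology \<Rightarrow> 'a set set \<Rightarrow> 'a set \<Rightarrow> 'a set \<Rightarrow> bool" where
  "isolates X V N S \<longleftrightarrow> closedin X N \<and> S \<subseteq> N
     \<and> (\<forall>\<phi> a b. path_in X V N \<phi> a b \<and> \<phi> a \<in> S \<and> \<phi> b \<in> S \<longrightarrow> \<phi> ` {a..b} \<subseteq> S)
     \<and> PiV_set X V S \<subseteq> N"

definition isolated_invariant :: "'a topology \<Rightarrow> 'a set set \<Rightarrow> 'a set \<Rightarrow> bool" where
  "isolated_invariant X V S \<longleftrightarrow> invariant X V S \<and> (\<exists>N. isolates X V N S)"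

definition strongly_connected :: "'a topology \<Rightarrow> 'a set set \<Rightarrow> 'a set \<Rightarrow> bool" where
  "strongly_connected X V A \<longleftrightarrow> A \<noteq> {} \<and>
     (\<forall>x\<in>A. \<forall>y\<in>A. \<exists>\<phi> a b. path_in X V A \<phi> a b \<and> \<phi> a = x \<and> \<phi> b = y)"

definition uim_minus :: "(int \<Rightarrow> 'a) \<Rightarrow> 'a set" where
  "uim_minus \<phi> = (\<Inter>t\<in>{..0}. \<phi> ` {..t})"

definition uim_plus :: "(int \<Rightarrow> 'a) \<Rightarrow> 'a set" where
  "uim_plus \<phi> = (\<Inter>t\<in>{0..}. \<phi> ` {t..})"

definition Vhull :: "'a topology \<Rightarrow> 'a set set \<Rightarrow> 'a set \<Rightarrow> 'a set" where
  "Vhull X V A = \<Inter>{B. B \<subseteq> topspace X \<and> compatible X V B \<and> locally_closed_in X B \<and> A \<subseteq> B}"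

definition alpha_limit :: "'a topology \<Rightarrow> 'a set set \<Rightarrow> (int \<Rightarrow> 'a) \<Rightarrow> 'a set" where
  "alpha_limit X V \<phi> = Vhull X V (uim_minus \<phi>)"

definition omega_limit :: "'a topology \<Rightarrow> 'a set set \<Rightarrow> (int \<Rightarrow> 'a) \<Rightarrow> 'a set" where
  "omega_limit X V \<phi> = Vhull X V (uim_plus \<phi>)"

end

theory Submission
  imports Defs
begin

text \<open>
  Let \<open>U\<close> be the set of points that \<open>\<phi>\<close> visits infinitely often in the given time direction. By
  finiteness \<open>\<phi>\<close> eventually stays in \<open>U\<close>, so \<open>U\<close> is nonempty and strongly connected, and if \<open>U\<close>
  lies in one multivector, that multivector is critical because \<open>\<phi>\<close> is essential. The points
  of the hull \<open>H\<close> of \<open>U\<close> that are joined to \<open>U\<close> in both directions by paths inside \<open>H\<close> form a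
  compatible, locally closed set containing \<open>U\<close>, hence all of \<open>H\<close>. So \<open>H\<close> is strongly
  connected. Through a point of \<open>H\<close> there is then either a constant solution in a critical
  multivector, or a periodic one that visits two multivectors. Finally, the closure of \<open>H\<close>
  isolates \<open>H\<close>, as paths in it cannot come back from the closed set \<open>mo H\<close>.
\<close>

section \<open>Locally closed sets\<close>

lemma locally_closed_in_topspace: "locally_closed_in X (topspace X)"
  unfolding locally_closed_in_def using openin_topspace closedin_topspace by blast

lemma locally_closed_in_Int:
  assumes "locally_closed_in X A" "locally_closed_in X B"
  shows "locally_closed_in X (A \<inter> B)"
proof -
  obtain U C U' C' where "openin X U" "closedin X C" "A = U \<inter> C"
    "openin X U'" "closedin X C'" "B = U' \<inter> C'"
    using assms unfolding locally_closed_in_def by blast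
  then have "openin X (U \<inter> U')" "closedin X (C \<inter> C')" "A \<inter> B = (U \<inter> U') \<inter> (C \<inter> C')"
    by (auto intro: openin_Int closedin_Int)
  then show ?thesis
    unfolding locally_closed_in_def by blast
qed

lemma locally_closed_in_Inter:
  assumes "finite \<F>" "\<F> \<noteq> {}" "\<And>A. A \<in> \<F> \<Longrightarrow> locally_closed_in X A"
  shows "locally_closed_in X (\<Inter>\<F>)"
  using assms by (induction rule: finite_ne_induct) (auto intro: locally_closed_in_Int)

text \<open>In the preorder \<open>x \<in> X closure_of {y}\<close>, open sets are closed upwards
  and closed sets downwards, so their intersections are convex.\<close>

lemma locally_closed_in_convex:
  assumes "locally_closed_in X A" "x \<in> A" "z \<in> A"
    and "x \<in> X closure_of {y}" "y \<in> X closure_of {z}"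
  shows "y \<in> A"
proof -
  obtain U C where UC: "openin X U" "closedin X C" "A = U \<inter> C"
    using assms(1) unfolding locally_closed_in_def by blast
  have "y \<in> U"
    using assms(2,4) UC by (auto simp: in_closure_of)
  moreover have "y \<in> C"
    using assms(3,5) UC closure_of_minimal[of "{z}" C X] by auto
  ultimately show ?thesis
    using UC by simp
qed

lemma closure_of_finite:
  assumes "finite A"
  shows "X closure_of A = (\<Union>x\<in>A. X closure_of {x})"
  using assms
proof (induction rule: finite_induct)
  case (insert x A)
  then show ?case
    using closure_of_Un[of X "{x}" A] by simp
qed simp

lemma closure_of_singleton_trans:
  "x \<in> X closure_of {y} \<Longrightarrow> y \<in> X closure_of {z} \<Longrightarrow> x \<in> X closure_of {z}"
  by (simp add: in_closure_of)

text \<open>Converse for finite spaces: a convex set is the intersection of its up-closure, which is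
  open, with its down-closure, which is the topological closure.\<close>

lemma locally_closed_in_if_convex:
  assumes fin: "finite (topspace X)" and "A \<subseteq> topspace X"
    and convex: "\<And>x y z. x \<in> A \<Longrightarrow> z \<in> A \<Longrightarrow> x \<in> X closure_of {y} \<Longrightarrow> y \<in> X closure_of {z} \<Longrightarrow> y \<in> A"
  shows "locally_closed_in X A"
proof -
  \<comment> \<open>\<open>D\<close> is the complement of the up-closure of \<open>A\<close>. It
    contains the closure of each of its points, which makes it closed because it is finite.\<close>
  define D where "D = {y \<in> topspace X. X closure_of {y} \<inter> A = {}}"
  have "finite D"
    using fin by (simp add: D_def)
  have "X closure_of D \<subseteq> D"
  proof
    fix z assume "z \<in> X closure_of D"
    then obtain y where y: "y \<in> D" "z \<in> X closure_of {y}"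
      unfolding closure_of_finite[OF \<open>finite D\<close>] by blast
    then have "X closure_of {z} \<subseteq> X closure_of {y}"
      using closure_of_singleton_trans by (metis subsetI)
    moreover have "z \<in> topspace X"
      using y(2) by (simp add: in_closure_of)
    ultimately show "z \<in> D"
      using y(1) unfolding D_def by blast
  qed
  moreover have "D \<subseteq> topspace X"
    by (auto simp: D_def)
  ultimately have "closedin X D"
    by (simp add: closure_of_subset_eq[symmetric])
  then have "openin X (topspace X - D)"
    by blast
  moreover have "A = (topspace X - D) \<inter> X closure_of A"
  proof
    show "A \<subseteq> (topspace X - D) \<inter> X closure_of A"
    proof
      fix x assume "x \<in> A"
      then have "x \<in> X closure_of {x}" "x \<in> X closure_of A" "x \<in> topspace X"
        using assms(2) by (auto simp: in_closure_of)
      then show "x \<in> (topspace X - D) \<inter> X closure_of A"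
        using \<open>x \<in> A\<close> by (auto simp: D_def)
    qed
    have "finite A"
      using fin assms(2) finite_subset by blast
    show "(topspace X - D) \<inter> X closure_of A \<subseteq> A"
    proof
      fix y assume y: "y \<in> (topspace X - D) \<inter> X closure_of A"
      then obtain z where "z \<in> A" "y \<in> X closure_of {z}"
        unfolding closure_of_finite[OF \<open>finite A\<close>] by blast
      moreover obtain x where "x \<in> A" "x \<in> X closure_of {y}"
        using y unfolding D_def by blast
      ultimately show "y \<in> A"
        using convex by blast
    qed
  qed
  ultimately show ?thesis
    unfolding locally_closed_in_def using closedin_closure_of by blast
qed

text \<open>Since the closure of \<open>A = U \<inter> C\<close> lies in \<open>C\<close>, removing
  \<open>A\<close> from it amounts to removing the open set \<open>U\<close>.\<close>

lemma closedin_mo: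
  assumes "locally_closed_in X A"
  shows "closedin X (mo X A)"
proof -
  obtain U C where UC: "openin X U" "closedin X C" "A = U \<inter> C"
    using assms unfolding locally_closed_in_def by blast
  then have "X closure_of A \<subseteq> C"
    by (simp add: closure_of_minimal)
  then have "mo X A = X closure_of A - U"
    using UC by (auto simp: mo_def)
  then show ?thesis
    using UC by (simp add: closedin_diff)
qed

section \<open>Multivector fields\<close>

lemma cell_eq:
  assumes "multivector_field X V" "A \<in> V" "x \<in> A"
  shows "cell V x = A"
proof -
  have "disjoint V"
    using assms(1) unfolding multivector_field_def partition_on_def by blast
  then show ?thesis
    unfolding cell_def using assms(2,3) by (auto simp: disjoint_def intro!: the_equality)
qed

lemma cell_in:
  assumes "multivector_field X V" "x \<in> topspace X"
  shows "cell V x \<in> V" "x \<in> cell V x"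
proof -
  obtain A where "A \<in> V" "x \<in> A"
    using assms unfolding multivector_field_def partition_on_def by blast
  then show "cell V x \<in> V" "x \<in> cell V x"
    using cell_eq[OF assms(1)] by auto
qed

lemma cell_subset_topspace:
  "multivector_field X V \<Longrightarrow> x \<in> topspace X \<Longrightarrow> cell V x \<subseteq> topspace X"
  using cell_in(1)[of X V x] unfolding multivector_field_def partition_on_def by blast

lemma cell_eqI:
  assumes "multivector_field X V" "x \<in> topspace X" "y \<in> cell V x"
  shows "cell V y = cell V x"
  using cell_eq[OF assms(1) cell_in(1)[OF assms(1,2)] assms(3)] .

lemma PiV_refl:
  "multivector_field X V \<Longrightarrow> x \<in> topspace X \<Longrightarrow> x \<in> PiV X V x"
  by (simp add: PiV_def cell_in(2))

lemma Vhull_superset: "A \<subseteq> Vhull X V A"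
  unfolding Vhull_def by blast

lemma Vhull_subset:
  "B \<subseteq> topspace X \<Longrightarrow> compatible X V B \<Longrightarrow> locally_closed_in X B \<Longrightarrow> A \<subseteq> B \<Longrightarrow> Vhull X V A \<subseteq> B"
  unfolding Vhull_def by blast

lemma compatible_topspace: "multivector_field X V \<Longrightarrow> compatible X V (topspace X)"
  by (simp add: compatible_def cell_subset_topspace)

lemma Vhull_subset_topspace:
  "multivector_field X V \<Longrightarrow> A \<subseteq> topspace X \<Longrightarrow> Vhull X V A \<subseteq> topspace X"
  by (simp add: Vhull_subset compatible_topspace locally_closed_in_topspace)

lemma compatible_Vhull: "compatible X V (Vhull X V A)"
  unfolding compatible_def Vhull_def by blast

lemma locally_closed_in_Vhull:
  assumes "finite (topspace X)" "multivector_field X V" "A \<subseteq> topspace X"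
  shows "locally_closed_in X (Vhull X V A)"
  unfolding Vhull_def
proof (rule locally_closed_in_Inter)
  show "finite {B. B \<subseteq> topspace X \<and> compatible X V B \<and> locally_closed_in X B \<and> A \<subseteq> B}"
    using assms(1) by simp
  \<comment> \<open>The whole space is a member; the intersection of an empty family would be
    \<open>UNIV\<close>.\<close>
  show "{B. B \<subseteq> topspace X \<and> compatible X V B \<and> locally_closed_in X B \<and> A \<subseteq> B} \<noteq> {}"
    using assms compatible_topspace locally_closed_in_topspace by blast
qed simp

section \<open>Paths\<close>

text \<open>Turns paths in \<open>A\<close> into the reflexive transitive closure of a relation, so
  that joining paths is transitivity.\<close>

definition step :: "'a topology \<Rightarrow> 'a set set \<Rightarrow> 'a set \<Rightarrow> 'a rel" where
  "step X V A = {(x, y). x \<in> A \<and> y \<in> A \<and> y \<in> PiV X V x}"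

lemma step_mono: "A \<subseteq> B \<Longrightarrow> step X V A \<subseteq> step X V B"
  unfolding step_def by blast

lemma step_closure: "x \<in> A \<Longrightarrow> y \<in> A \<Longrightarrow> y \<in> X closure_of {x} \<Longrightarrow> (x, y) \<in> step X V A"
  by (simp add: step_def PiV_def)

lemma step_cell: "x \<in> A \<Longrightarrow> y \<in> A \<Longrightarrow> y \<in> cell V x \<Longrightarrow> (x, y) \<in> step X V A"
  by (simp add: step_def PiV_def)

text \<open>The reflexive closure relates every point to itself, even outside \<open>A\<close>, so
  the chain of length zero needs \<open>x \<in> A\<close>.\<close>

lemma path_in_if_steps:
  assumes "(x, y) \<in> (step X V A)\<^sup>*" "x \<in> A"
  shows "\<exists>\<psi> a b. path_in X V A \<psi> a b \<and> \<psi> a = x \<and> \<psi> b = y"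
proof -
  obtain n where "(x, y) \<in> step X V A ^^ n"
    using assms(1) rtrancl_imp_relpow by blast
  then obtain f where f: "f 0 = x" "f n = y" "\<And>i. i < n \<Longrightarrow> (f i, f (Suc i)) \<in> step X V A"
    unfolding relpow_fun_conv by blast
  have "f i \<in> A" if "i \<le> n" for i
    using that f assms(2) by (cases i) (auto simp: step_def)
  then have "path_in X V A (\<lambda>i. f (nat i)) 0 (int n)"
    using f(3) by (auto simp: path_in_def step_def nat_add_distrib)
  then show ?thesis
    using f(1,2) by (metis nat_0 nat_int)
qed

lemma steps_along_solution:
  assumes "full_solution X V B \<psi>" "s \<le> t" "\<And>i. s \<le> i \<Longrightarrow> i \<le> t \<Longrightarrow> \<psi> i \<in> A"
  shows "(\<psi> s, \<psi> t) \<in> (step X V A)\<^sup>*"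
  using assms(2,3)
proof (induction rule: int_ge_induct)
  case (step i)
  have "(\<psi> i, \<psi> (i + 1)) \<in> step X V A"
    using assms(1) step.hyps step.prems by (auto simp: step_def full_solution_def)
  then show ?case
    using step by (meson order.trans rtrancl.rtrancl_into_rtrancl zle_add1_eq_le less_le order_refl)
qed simp

text \<open>The walk from \<open>x\<close> to \<open>y\<close> and back is repeated forever in both
  time directions. As \<open>x \<noteq> y\<close>, its period is positive.\<close>

lemma periodic_solution:
  assumes "(x, y) \<in> (step X V A)\<^sup>*" "(y, x) \<in> (step X V A)\<^sup>*" "x \<noteq> y"
  obtains \<psi> where "full_solution X V A \<psi>" "\<psi> 0 = x"
    "\<And>n. \<exists>s<n. \<psi> s = x" "\<And>n. \<exists>s>n. \<psi> s = x" "\<And>n. \<exists>s<n. \<psi> s = y" "\<And>n. \<exists>s>n. \<psi> s = y"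
proof -
  obtain m k where mk: "(x, y) \<in> step X V A ^^ m" "(y, x) \<in> step X V A ^^ k"
    using assms(1,2) rtrancl_imp_relpow by metis
  then obtain f g where f: "f 0 = x" "f m = y" "\<And>i. i < m \<Longrightarrow> (f i, f (Suc i)) \<in> step X V A"
    and g: "g 0 = y" "g k = x" "\<And>i. i < k \<Longrightarrow> (g i, g (Suc i)) \<in> step X V A"
    unfolding relpow_fun_conv by metis
  define n where "n = m + k"
  \<comment> \<open>One period: the two chains agree at the joint \<open>m\<close>, where
    \<open>f m = g 0 = y\<close>.\<close>
  define h where "h = (\<lambda>i. if i \<le> m then f i else g (i - m))"
  have "m > 0" "k > 0"
    using f(1,2) g(1,2) assms(3) by (auto intro: gr0I)
  have h: "h 0 = x" "h m = y" "h n = x"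
    using f g \<open>k > 0\<close> by (auto simp: h_def n_def)
  have h_step: "(h i, h (Suc i)) \<in> step X V A" if "i < n" for i
  proof (cases i m rule: linorder_cases)
    case equal
    then show ?thesis
      using f(2) g(1) g(3)[OF \<open>k > 0\<close>] by (simp add: h_def)
  next
    case greater
    then have "Suc i - m = Suc (i - m)" "i - m < k"
      using that by (auto simp: n_def)
    then show ?thesis
      using greater g(3)[of "i - m"] by (simp add: h_def)
  qed (use f(3) in \<open>auto simp: h_def\<close>)
  have "n > 0"
    using \<open>m > 0\<close> by (simp add: n_def)
  \<comment> \<open>The remainder by a positive number is nonnegative, so negative times are covered
    as well.\<close>
  define \<psi> where "\<psi> = (\<lambda>i. h (nat (i mod int n)))"
  have \<psi>_step: "(\<psi> i, \<psi> (i + 1)) \<in> step X V A" for i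
  proof -
    define j where "j = nat (i mod int n)"
    have j: "j < n" "i mod int n = int j"
      using \<open>n > 0\<close> by (auto simp: j_def nat_less_iff)
    \<comment> \<open>At the end of a period the remainder falls from \<open>n - 1\<close> to
      \<open>0\<close>; this is harmless because \<open>h n = h 0\<close>.\<close>
    have "\<psi> (i + 1) = h (Suc j)"
    proof (cases "Suc j = n")
      case True
      then have "(i + 1) mod int n = 0"
        using j by (metis mod_add_left_eq mod_self of_nat_Suc add.commute)
      then show ?thesis
        using True h by (simp add: \<psi>_def)
    next
      case False
      then have "(i + 1) mod int n = int (Suc j)"
        using j by (metis mod_add_left_eq of_nat_Suc add.commute Suc_lessI mod_less of_nat_mod)
      then show ?thesis
        by (simp only: \<psi>_def nat_int)
    qed
    then show ?thesis
      using h_step[OF j(1)] by (simp add: \<psi>_def j_def)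
  qed
  have per: "\<psi> (i + int n * c) = \<psi> i" for i c
    by (simp add: \<psi>_def)
  have "m < n"
    using \<open>k > 0\<close> by (simp add: n_def)
  have "\<psi> 0 = x" "\<psi> (int m) = y"
    using h \<open>m < n\<close> by (auto simp: \<psi>_def)
  have below: "\<exists>s<l. \<psi> s = \<psi> i" and above: "\<exists>s>l. \<psi> s = \<psi> i" for i l
  proof -
    \<comment> \<open>Shifting \<open>i\<close> by \<open>c\<close> periods moves it by at least
      \<open>c > \<bar>l\<bar> + \<bar>i\<bar>\<close>, hence past \<open>l\<close> on either
      side.\<close>
    define c where "c = \<bar>l\<bar> + \<bar>i\<bar> + 1"
    have "int n * c \<ge> c"
      using \<open>n > 0\<close> by (simp add: c_def)
    moreover have "c > \<bar>l\<bar> + \<bar>i\<bar>"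
      by (simp add: c_def)
    ultimately have "i + int n * (-c) < l" "i + int n * c > l"
      unfolding mult_minus_right by linarith+
    then show "\<exists>s<l. \<psi> s = \<psi> i" "\<exists>s>l. \<psi> s = \<psi> i"
      using per by blast+
  qed
  have "full_solution X V A \<psi>"
    using \<psi>_step by (auto simp: full_solution_def step_def)
  then show ?thesis
    using that[of \<psi>] below above \<open>\<psi> 0 = x\<close> \<open>\<psi> (int m) = y\<close> by metis
qed

section \<open>Hulls of strongly connected sets\<close>

text \<open>The set \<open>K\<close> of points communicating with a fixed \<open>u \<in> U\<close>
  inside the hull meets every requirement in the definition of the hull, so minimality leaves no
  point outside \<open>K\<close>.\<close>

lemma steps_in_Vhull:
  assumes "finite (topspace X)" "multivector_field X V" "U \<subseteq> topspace X"
    and U: "\<And>x y. x \<in> U \<Longrightarrow> y \<in> U \<Longrightarrow> (x, y) \<in> (step X V U)\<^sup>*"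
    and "x \<in> Vhull X V U" "y \<in> Vhull X V U" "U \<noteq> {}"
  shows "(x, y) \<in> (step X V (Vhull X V U))\<^sup>*"
proof -
  define H where "H = Vhull X V U"
  obtain u where "u \<in> U"
    using \<open>U \<noteq> {}\<close> by blast
  define K where "K = {y \<in> H. (u, y) \<in> (step X V H)\<^sup>* \<and> (y, u) \<in> (step X V H)\<^sup>*}"
  have "H \<subseteq> topspace X" "U \<subseteq> H" "compatible X V H" "locally_closed_in X H"
    unfolding H_def
    using assms by (auto simp: Vhull_subset_topspace compatible_Vhull locally_closed_in_Vhull
      Vhull_superset[THEN subsetD] dest: Vhull_subset_topspace[THEN subsetD])
  have "K \<subseteq> topspace X"
    using \<open>H \<subseteq> topspace X\<close> by (auto simp: K_def)
  have "compatible X V K"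
    unfolding compatible_def disj_imp
  proof (intro ballI impI)
    fix x assume x: "x \<in> topspace X" "cell V x \<inter> K \<noteq> {}"
    then obtain y where y: "y \<in> cell V x" "y \<in> K"
      by blast
    show "cell V x \<subseteq> K"
    proof
      fix z assume z: "z \<in> cell V x"
      have "y \<in> H"
        using y by (simp add: K_def)
      then have "z \<in> H"
        using \<open>compatible X V H\<close> x(1) y(1) z unfolding compatible_def by blast
      \<comment> \<open>Points of one multivector reach each other in one step, so \<open>K\<close>
        contains every cell that it meets.\<close>
      have "cell V y = cell V x" "cell V z = cell V x"
        using cell_eqI[OF assms(2) x(1)] y(1) z by simp_all
      then have "(y, z) \<in> step X V H" "(z, y) \<in> step X V H"
        using y z \<open>y \<in> H\<close> \<open>z \<in> H\<close> by (auto intro: step_cell)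
      then show "z \<in> K"
        using y(2) \<open>z \<in> H\<close> unfolding K_def
        by (auto intro: rtrancl_into_rtrancl converse_rtrancl_into_rtrancl)
    qed
  qed
  moreover have "locally_closed_in X K"
  proof (rule locally_closed_in_if_convex[OF assms(1) \<open>K \<subseteq> topspace X\<close>])
    fix x y z assume xyz: "x \<in> K" "z \<in> K" "x \<in> X closure_of {y}" "y \<in> X closure_of {z}"
    then have "y \<in> H"
      using locally_closed_in_convex[OF \<open>locally_closed_in X H\<close>] by (auto simp: K_def)
    \<comment> \<open>Moves into a closure go down the preorder: \<open>z\<close> leads to
      \<open>y\<close>, and \<open>y\<close> to \<open>x\<close>. As \<open>z\<close> and
      \<open>x\<close> communicate with \<open>u\<close>, so does \<open>y\<close>.\<close>
    then have "(z, y) \<in> step X V H" "(y, x) \<in> step X V H"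
      using xyz by (auto simp: K_def intro: step_closure)
    then show "y \<in> K"
      using xyz(1,2) \<open>y \<in> H\<close> unfolding K_def
      by (auto intro: rtrancl_into_rtrancl converse_rtrancl_into_rtrancl)
  qed
  moreover have "U \<subseteq> K"
    using U \<open>u \<in> U\<close> \<open>U \<subseteq> H\<close> rtrancl_mono[OF step_mono[OF \<open>U \<subseteq> H\<close>]] unfolding K_def by blast
  ultimately have "H \<subseteq> K"
    unfolding H_def using Vhull_subset \<open>K \<subseteq> topspace X\<close> by blast
  then show ?thesis
    using assms(5,6) unfolding K_def H_def by (blast intro: rtrancl_trans)
qed

text \<open>A point of \<open>mo X H\<close> cannot step into \<open>H\<close>: moves into its
  closure stay in the closed set \<open>mo X H\<close>, and moves within its multivector avoid the
  compatible set \<open>H\<close>. So a path in the closure of \<open>H\<close> that has left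
  \<open>H\<close> never returns.\<close>

lemma isolates_closure:
  assumes mvf: "multivector_field X V" and "H \<subseteq> topspace X"
    and comp: "compatible X V H" and "locally_closed_in X H"
  shows "isolates X V (X closure_of H) H"
proof -
  have sub: "H \<subseteq> X closure_of H"
    using assms(2) by (simp add: closure_of_subset)
  have "PiV X V x \<subseteq> X closure_of H" if "x \<in> H" for x
  proof -
    have "cell V x \<subseteq> H"
      using comp that assms(2) cell_in(2)[OF mvf] unfolding compatible_def by blast
    moreover have "X closure_of {x} \<subseteq> X closure_of H"
      using that by (simp add: closure_of_mono)
    ultimately show ?thesis
      using sub by (auto simp: PiV_def)
  qed
  then have "PiV_set X V H \<subseteq> X closure_of H"
    unfolding PiV_set_def by blast
  have exit: "y \<notin> H" if "x \<in> X closure_of H" "x \<notin> H" "y \<in> PiV X V x" for x y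
  proof (cases "y \<in> cell V x")
    case True
    have "x \<in> topspace X"
      using that(1) by (simp add: in_closure_of)
    then show ?thesis
      using True that(2) comp cell_in(2)[OF mvf] unfolding compatible_def by blast
  next
    case False
    have "X closure_of {x} \<subseteq> mo X H"
      using that(1,2) closedin_mo[OF assms(4)] by (intro closure_of_minimal) (auto simp: mo_def)
    then show ?thesis
      using that(3) False by (auto simp: PiV_def mo_def)
  qed
  have "\<psi> i \<in> H"
    if path: "path_in X V (X closure_of H) \<psi> a b" and "\<psi> b \<in> H" and i: "i \<in> {a..b}" for \<psi> a b i
  proof (rule ccontr)
    assume "\<psi> i \<notin> H"
    have "i \<le> b"
      using i by simp
    \<comment> \<open>The guard \<open>j \<le> b\<close> confines the induction to times where the
      path conditions hold; its instance \<open>j = b\<close> gives the contradiction.\<close>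
    then have "b \<le> b \<longrightarrow> \<psi> b \<notin> H"
    proof (induction rule: int_ge_induct[where P = "\<lambda>j. j \<le> b \<longrightarrow> \<psi> j \<notin> H"])
      case (step j)
      then show ?case
        using path i exit[of "\<psi> j" "\<psi> (j + 1)"] by (auto simp: path_in_def)
    qed (use \<open>\<psi> i \<notin> H\<close> in simp)
    then show False
      using \<open>\<psi> b \<in> H\<close> by simp
  qed
  then have "\<psi> ` {a..b} \<subseteq> H" if "path_in X V (X closure_of H) \<psi> a b" "\<psi> b \<in> H" for \<psi> a b
    using that by (meson image_subsetI)
  then show ?thesis
    unfolding isolates_def using sub \<open>PiV_set X V H \<subseteq> X closure_of H\<close> by simp
qed

text \<open>Common core for both limit sets. The assumption \<open>crit\<close> rules out a hull
  confined to a regular multivector, where no essential solution could live.\<close>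

lemma Vhull_strongly_connected_isolated_invariant:
  assumes fin: "finite (topspace X)" and mvf: "multivector_field X V"
    and "U \<subseteq> topspace X" "U \<noteq> {}"
    and U: "\<And>x y. x \<in> U \<Longrightarrow> y \<in> U \<Longrightarrow> (x, y) \<in> (step X V U)\<^sup>*"
    and crit: "\<And>x. x \<in> topspace X \<Longrightarrow> U \<subseteq> cell V x \<Longrightarrow> critical X (cell V x)"
  shows "Vhull X V U \<noteq> {} \<and> strongly_connected X V (Vhull X V U)
    \<and> isolated_invariant X V (Vhull X V U)"
proof -
  define H where "H = Vhull X V U"
  have H: "H \<subseteq> topspace X" "U \<subseteq> H" "compatible X V H" "locally_closed_in X H"
    unfolding H_def
    using assms by (auto simp: Vhull_subset_topspace compatible_Vhull locally_closed_in_Vhull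
      Vhull_superset[THEN subsetD] dest: Vhull_subset_topspace[THEN subsetD])
  then have "H \<noteq> {}"
    using \<open>U \<noteq> {}\<close> by blast
  have steps: "(x, y) \<in> (step X V H)\<^sup>*" if "x \<in> H" "y \<in> H" for x y
    using that steps_in_Vhull[OF fin mvf \<open>U \<subseteq> topspace X\<close> U _ _ \<open>U \<noteq> {}\<close>] unfolding H_def by blast
  have "strongly_connected X V H"
    unfolding strongly_connected_def using \<open>H \<noteq> {}\<close> steps path_in_if_steps by metis
  have "\<exists>\<psi>. full_solution X V H \<psi> \<and> essential X V \<psi> \<and> \<psi> 0 = x" if x: "x \<in> H" for x
  proof (cases "H \<subseteq> cell V x")
    case True
    have "x \<in> topspace X"
      using that H by blast
    then have "critical X (cell V x)"
      using True H crit by blast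
    \<comment> \<open>A constant solution never leaves its multivector; it is essential because that
      multivector is critical.\<close>
    then have "full_solution X V H (\<lambda>_. x) \<and> essential X V (\<lambda>_. x)"
      using that \<open>x \<in> topspace X\<close> PiV_refl[OF mvf]
      by (simp add: full_solution_def essential_def regular_def)
    then show ?thesis
      by blast
  next
    case False
    then obtain y where y: "y \<in> H" "y \<notin> cell V x"
      by blast
    have top: "x \<in> topspace X" "y \<in> topspace X"
      using that y H by blast+
    have "x \<noteq> y"
      using y cell_in(2)[OF mvf \<open>x \<in> topspace X\<close>] by blast
    then obtain \<psi> where \<psi>: "full_solution X V H \<psi>" "\<psi> 0 = x"
      "\<And>n. \<exists>s<n. \<psi> s = x" "\<And>n. \<exists>s>n. \<psi> s = x" "\<And>n. \<exists>s<n. \<psi> s = y" "\<And>n. \<exists>s>n. \<psi> s = y"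
      using periodic_solution[OF steps[OF x y(1)] steps[OF y(1) x]] by metis
    \<comment> \<open>Since \<open>x\<close> and \<open>y\<close> lie in different cells, every cell
      misses one of them, and that point is visited arbitrarily far in both directions, as
      essentiality demands.\<close>
    have "x \<notin> cell V (\<psi> t) \<or> y \<notin> cell V (\<psi> t)" for t
    proof -
      have "\<psi> t \<in> topspace X"
        using \<psi>(1) H(1) by (auto simp: full_solution_def)
      then show ?thesis
        using y(2) cell_eqI[OF mvf] by metis
    qed
    then have "essential X V \<psi>"
      unfolding essential_def using \<psi>(3-6) by metis
    then show ?thesis
      using \<psi> by blast
  qed
  then have "invariant X V H"
    unfolding invariant_def Inv_def by blast
  then have "isolated_invariant X V H"
    unfolding isolated_invariant_def using isolates_closure[OF mvf H(1,3,4)] by blast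
  then show ?thesis
    using \<open>H \<noteq> {}\<close> \<open>strongly_connected X V H\<close> unfolding H_def by blast
qed

section \<open>Limit sets\<close>

lemma uim_plus_iff: "x \<in> uim_plus \<psi> \<longleftrightarrow> (\<forall>n. \<exists>s\<ge>n. \<psi> s = x)"
proof
  assume x: "x \<in> uim_plus \<psi>"
  show "\<forall>n. \<exists>s\<ge>n. \<psi> s = x"
  proof
    fix n
    \<comment> \<open>The intersection defining \<open>uim_plus\<close> ranges over nonnegative
      times only, hence \<open>max 0 n\<close>.\<close>
    have "x \<in> \<psi> ` {max 0 n..}"
      using x unfolding uim_plus_def by (meson INT_D atLeast_iff max.cobounded1)
    then show "\<exists>s\<ge>n. \<psi> s = x"
      by auto
  qed
next
  assume "\<forall>n. \<exists>s\<ge>n. \<psi> s = x"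
  then show "x \<in> uim_plus \<psi>"
    unfolding uim_plus_def by fastforce
qed

text \<open>Each value outside \<open>uim_plus \<psi>\<close> is avoided from some time on, and
  there are finitely many such values, so one time serves for all.\<close>

lemma eventually_in_uim_plus:
  assumes "finite (range \<psi>)"
  obtains t where "\<And>s. s \<ge> t \<Longrightarrow> \<psi> s \<in> uim_plus \<psi>"
proof -
  have "\<forall>y \<in> range \<psi> - uim_plus \<psi>. \<exists>n. \<forall>s\<ge>n. \<psi> s \<noteq> y"
    by (auto simp: uim_plus_iff)
  then obtain N where N: "\<And>y s. y \<in> range \<psi> - uim_plus \<psi> \<Longrightarrow> s \<ge> N y \<Longrightarrow> \<psi> s \<noteq> y"
    by metis
  \<comment> \<open>Inserting \<open>0\<close> keeps \<open>Max\<close> away from the empty set,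
    which would occur when every value recurs.\<close>
  define T where "T = Max (insert 0 (N ` (range \<psi> - uim_plus \<psi>)))"
  have "N y \<le> T" if "y \<in> range \<psi> - uim_plus \<psi>" for y
    using that assms unfolding T_def by (intro Max_ge) auto
  then have "\<psi> s \<in> uim_plus \<psi>" if "s \<ge> T" for s
    using that N by (metis Diff_iff order_trans rangeI)
  then show ?thesis
    using that by blast
qed

text \<open>Time reversal transfers the facts about recurring values to the negative
  direction.\<close>

lemma uim_minus_eq_uim_plus: "uim_minus \<psi> = uim_plus (\<lambda>i. \<psi> (- i))"
proof -
  have "(\<lambda>i. \<psi> (- i)) ` {t..} = \<psi> ` {..- t}" for t
    by (simp only: image_image[symmetric, of \<psi> uminus] image_uminus_atLeast)
  then have "uim_plus (\<lambda>i. \<psi> (- i)) = (\<Inter>t\<in>{0..}. \<psi> ` {..- t})"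
    by (simp add: uim_plus_def)
  also have "\<dots> = (\<Inter>t\<in>uminus ` {0..}. \<psi> ` {..t})"
    by (simp only: image_image)
  also have "\<dots> = uim_minus \<psi>"
    by (simp only: uim_minus_def image_uminus_atLeast minus_zero)
  finally show ?thesis ..
qed

lemma uim_minus_iff: "x \<in> uim_minus \<psi> \<longleftrightarrow> (\<forall>n. \<exists>s\<le>n. \<psi> s = x)"
  unfolding uim_minus_eq_uim_plus uim_plus_iff by (metis minus_minus neg_le_iff_le)

lemma eventually_in_uim_minus:
  assumes "finite (range \<psi>)"
  obtains t where "\<And>s. s \<le> t \<Longrightarrow> \<psi> s \<in> uim_minus \<psi>"
proof -
  have "finite (range (\<lambda>i. \<psi> (- i)))"
    using assms by (rule finite_subset[rotated]) auto
  then obtain t where "\<And>s. s \<ge> t \<Longrightarrow> \<psi> (- s) \<in> uim_minus \<psi>"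
    using eventually_in_uim_plus unfolding uim_minus_eq_uim_plus by metis
  then have "\<psi> s \<in> uim_minus \<psi>" if "s \<le> - t" for s
    using that by (metis minus_le_iff minus_minus)
  then show ?thesis
    using that by blast
qed

lemma omega_limit_strongly_connected_isolated_invariant:
  assumes fin: "finite (topspace X)" and mvf: "multivector_field X V"
    and sol: "full_solution X V (topspace X) \<phi>" and ess: "essential X V \<phi>"
  shows "omega_limit X V \<phi> \<noteq> {} \<and> strongly_connected X V (omega_limit X V \<phi>)
    \<and> isolated_invariant X V (omega_limit X V \<phi>)"
  unfolding omega_limit_def
proof (rule Vhull_strongly_connected_isolated_invariant[OF fin mvf])
  have top: "\<phi> i \<in> topspace X" for i
    using sol by (simp add: full_solution_def)
  then have "finite (range \<phi>)"
    using fin by (meson finite_subset image_subsetI)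
  then obtain t where t: "\<And>s. s \<ge> t \<Longrightarrow> \<phi> s \<in> uim_plus \<phi>"
    using eventually_in_uim_plus by blast
  show "uim_plus \<phi> \<noteq> {}"
    using t by blast
  show "uim_plus \<phi> \<subseteq> topspace X"
    using top by (metis subsetI uim_plus_iff)
  show "(x, y) \<in> (step X V (uim_plus \<phi>))\<^sup>*" if "x \<in> uim_plus \<phi>" "y \<in> uim_plus \<phi>" for x y
  proof -
    obtain s where s: "s \<ge> t" "\<phi> s = x"
      using \<open>x \<in> uim_plus \<phi>\<close> unfolding uim_plus_iff by blast
    \<comment> \<open>As \<open>y\<close> recurs, it is met again from time \<open>s\<close> on; the
      stretch from \<open>s\<close> to \<open>r\<close> lies beyond \<open>t\<close> and hence in
      \<open>uim_plus \<phi>\<close>.\<close>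
    obtain r where r: "r \<ge> s" "\<phi> r = y"
      using \<open>y \<in> uim_plus \<phi>\<close> unfolding uim_plus_iff by blast
    show ?thesis
      using steps_along_solution[OF sol r(1)] t s r by auto
  qed
  show "critical X (cell V x)" if x: "x \<in> topspace X" "uim_plus \<phi> \<subseteq> cell V x" for x
  proof (rule ccontr)
    assume "\<not> critical X (cell V x)"
    moreover have "cell V (\<phi> t) = cell V x"
      using cell_eqI[OF mvf x(1)] t[of t] x(2) by auto
    \<comment> \<open>An essential solution has to leave a regular multivector after time
      \<open>t\<close>, but from \<open>t\<close> on it stays in \<open>uim_plus \<phi>\<close>,
      inside that multivector.\<close>
    ultimately obtain s where "s > t" "\<phi> s \<notin> cell V x"
      using ess unfolding essential_def regular_def by metis
    then show False
      using t[of s] x(2) by auto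
  qed
qed

text \<open>A reversed solution need not be a solution, as \<open>PiV\<close> is not symmetric in
  general, so the argument for \<omega> is repeated with times before \<open>t\<close>.\<close>

lemma alpha_limit_strongly_connected_isolated_invariant:
  assumes fin: "finite (topspace X)" and mvf: "multivector_field X V"
    and sol: "full_solution X V (topspace X) \<phi>" and ess: "essential X V \<phi>"
  shows "alpha_limit X V \<phi> \<noteq> {} \<and> strongly_connected X V (alpha_limit X V \<phi>)
    \<and> isolated_invariant X V (alpha_limit X V \<phi>)"
  unfolding alpha_limit_def
proof (rule Vhull_strongly_connected_isolated_invariant[OF fin mvf])
  have top: "\<phi> i \<in> topspace X" for i
    using sol by (simp add: full_solution_def)
  then have "finite (range \<phi>)"
    using fin by (meson finite_subset image_subsetI)
  then obtain t where t: "\<And>s. s \<le> t \<Longrightarrow> \<phi> s \<in> uim_minus \<phi>"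
    using eventually_in_uim_minus by blast
  show "uim_minus \<phi> \<noteq> {}"
    using t by blast
  show "uim_minus \<phi> \<subseteq> topspace X"
    using top by (metis subsetI uim_minus_iff)
  show "(x, y) \<in> (step X V (uim_minus \<phi>))\<^sup>*" if "x \<in> uim_minus \<phi>" "y \<in> uim_minus \<phi>" for x y
  proof -
    \<comment> \<open>The end time \<open>r\<close> is chosen first and the start \<open>s\<close>
      before it, so that the path still runs forward from \<open>x\<close> to
      \<open>y\<close>.\<close>
    obtain r where r: "r \<le> t" "\<phi> r = y"
      using \<open>y \<in> uim_minus \<phi>\<close> unfolding uim_minus_iff by blast
    obtain s where s: "s \<le> r" "\<phi> s = x"
      using \<open>x \<in> uim_minus \<phi>\<close> unfolding uim_minus_iff by blast
    show ?thesis
      using steps_along_solution[OF sol s(1)] t s r by auto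
  qed
  show "critical X (cell V x)" if x: "x \<in> topspace X" "uim_minus \<phi> \<subseteq> cell V x" for x
  proof (rule ccontr)
    assume "\<not> critical X (cell V x)"
    moreover have "cell V (\<phi> t) = cell V x"
      using cell_eqI[OF mvf x(1)] t[of t] x(2) by auto
    ultimately obtain s where "s < t" "\<phi> s \<notin> cell V x"
      using ess unfolding essential_def regular_def by metis
    then show False
      using t[of s] x(2) by auto
  qed
qed

theorem theorem6p17:
  fixes X :: "'a topology" and V :: "'a set set" and \<phi> :: "int \<Rightarrow> 'a"
  assumes "finite_T0 X"
    and "multivector_field X V"
    and "invariant X V (topspace X)"
    and "full_solution X V (topspace X) \<phi>"
    and "essential X V \<phi>"
  shows "alpha_limit X V \<phi> \<noteq> {} \<and> strongly_connected X V (alpha_limit X V \<phi>)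
           \<and> isolated_invariant X V (alpha_limit X V \<phi>)
         \<and> omega_limit X V \<phi> \<noteq> {} \<and> strongly_connected X V (omega_limit X V \<phi>)
           \<and> isolated_invariant X V (omega_limit X V \<phi>)"
proof -
  have "finite (topspace X)"
    using assms(1) by (simp add: finite_T0_def)
  then show ?thesis
    using alpha_limit_strongly_connected_isolated_invariant
      omega_limit_strongly_connected_isolated_invariant assms(2,4,5) by blast
qed

end
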